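(* One has the disjoint union $\mathcal{P}_4=\mathcal{P}_{4,1}\sqcup\mathcal{P}_{4,2}$, and $$\mathcal{P}_4=\{s_2x^2+s_1x+s_0\colon s_0,s_1,s_2\in\mathbb{F}_4,\ s_1^3+s_2^3=1\},$$ where $$\mathcal{P}_{4,1}=\{s_1x+s_0\colon s_0,s_1\in\mathbb{F}_4,\ s_1^3=1\}\quad\text{and}\quad\mathcal{P}_{4,2}=\{s_2x^2+s_0\colon s_0,s_2\in\mathbb{F}_4,\ s_2^3=1\}.$$
   Context: $\mathbb{F}_4$ is the field with four elements. $\mathcal{P}_4$ is the set of polynomials in $\mathbb{F}_4[x]$ of degree less than $4$ that act as permutations of $\mathbb{F}_4$, and $\mathcal{P}_{4,d}$ is the subset of those of degree $d$. *)

theory Defs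
  imports "HOL-Computational_Algebra.Polynomial" "HOL-Library.Cardinality"
begin

text \<open>
  A finite field with \<open>q\<close> elements is a type \<open>'a\<close> of classes \<open>field\<close> and \<open>finite\<close> with
  \<open>CARD('a) = q\<close>; the field with four elements is the case \<open>CARD('a) = 4\<close>.
\<close>

definition perm_polys :: "'a::{field,finite} poly set" where
  "perm_polys = {p. degree p < CARD('a) \<and> bij (poly p)}"

definition perm_polys_deg :: "nat \<Rightarrow> 'a::{field,finite} poly set" where
  "perm_polys_deg d = {p \<in> perm_polys. degree p = d}"

end

theory Submission imports Defs
begin

text \<open>
  In \<open>\<F>\<^sub>4\<close> the power sums of all elements vanish for the exponents 1 and 2 but not for 3,
  so summing the values of a permutation polynomial shows that its cubic coefficient is zero.
  As the characteristic is 2, \<open>s\<^sub>2x\<^sup>2 + s\<^sub>1x\<close> is additive, hence injective iff it has no nonzero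
  root, i.e. iff exactly one of \<open>s\<^sub>1\<close>, \<open>s\<^sub>2\<close> is zero. Since cubes are 0 or 1, this is
  \<open>s\<^sub>1\<^sup>3 + s\<^sub>2\<^sup>3 = 1\<close>.
\<close>

text \<open>Multiplication by \<open>x\<close> permutes the nonzero elements, so it leaves their
  product unchanged while multiplying it by \<open>x\<close> once per factor. That product is
  nonzero and cancels.\<close>

lemma finite_field_power_pred_card:
  fixes x :: "'a::{field,finite}"
  assumes "x \<noteq> 0"
  shows "x ^ (CARD('a) - 1) = 1"
proof -
  let ?P = "\<Prod>y\<in>UNIV - {0::'a}. y"
  have "bij_betw ((*) x) (UNIV - {0}) (UNIV - {0})"
    by (rule bij_betw_byWitness[where f' = "\<lambda>y. y / x"]) (use assms in auto)
  then have "?P = (\<Prod>y\<in>UNIV - {0}. x * y)"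
    by (rule prod.reindex_bij_betw[symmetric])
  also have "\<dots> = x ^ (CARD('a) - 1) * ?P"
    by (simp add: prod.distrib)
  finally show ?thesis
    by simp
qed

text \<open>Translation by 1 permutes the field, yet adds one copy of 1 per element to the sum of
  all elements.\<close>

lemma finite_field_of_nat_card: "of_nat CARD('a) = (0::'a::{field,finite})"
proof -
  have "bij (\<lambda>y::'a. y + 1)"
    by (rule bij_betw_byWitness[where f' = "\<lambda>y. y - 1"]) auto
  then have "(\<Sum>y::'a\<in>UNIV. y) = (\<Sum>y\<in>UNIV. y + 1)"
    by (rule sum.reindex_bij_betw[symmetric])
  then show ?thesis
    by (simp add: sum.distrib)
qed

text \<open>Replacing \<open>y\<close> by \<open>c * y\<close> only reorders the terms of the sum,
  but multiplies it by \<open>c ^ k\<close>, which differs from 1.\<close>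

lemma finite_field_power_sum_eq_0:
  fixes c :: "'a::{field,finite}"
  assumes "c \<noteq> 0" "c ^ k \<noteq> 1"
  shows "(\<Sum>y::'a\<in>UNIV. y ^ k) = 0"
proof -
  let ?S = "\<Sum>y::'a\<in>UNIV. y ^ k"
  have "bij ((*) c)"
    by (rule bij_betw_byWitness[where f' = "\<lambda>y. y / c"]) (use assms in auto)
  then have "?S = (\<Sum>y\<in>UNIV. (c * y) ^ k)"
    by (rule sum.reindex_bij_betw[symmetric])
  also have "\<dots> = c ^ k * ?S"
    by (simp add: power_mult_distrib sum_distrib_left)
  finally show ?thesis
    using assms(2) by simp
qed

context
  assumes card4: "CARD('a::{field,finite}) = 4"
begin

text \<open>The cardinality 4 = 2 * 2 vanishes in the field, which has no zero divisors; hence 2 =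
  0.\<close>

lemma field4_add_self: "x + x = (0::'a)"
proof -
  have "(2::'a) * 2 = of_nat CARD('a)"
    using card4 by simp
  then have "(2::'a) * 2 = 0"
    by (simp only: finite_field_of_nat_card)
  then have "(2::'a) = 0"
    unfolding mult_eq_0_iff by blast
  then show ?thesis
    unfolding mult_2[symmetric] by (simp only: mult_zero_left)
qed

lemma field4_cube: "x ^ 3 = (if x = 0 then 0 else 1 :: 'a)"
  using finite_field_power_pred_card[of x] card4 by simp

lemma field4_power_sum_eq_0:
  assumes "k = 1 \<or> k = 2"
  shows "(\<Sum>y::'a\<in>UNIV. y ^ k) = 0"
proof -
  \<comment> \<open>Four elements leave room for some \<open>c\<close> besides 0 and 1, which serves
    as scaling factor for both exponents.\<close>
  have "card {0, 1::'a} \<noteq> CARD('a)"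
    using card4 by simp
  then have "{0, 1} \<noteq> (UNIV :: 'a set)"
    by metis
  then obtain c :: 'a where c: "c \<noteq> 0" "c \<noteq> 1"
    by blast
  \<comment> \<open>Otherwise \<open>c ^ 3 = c\<close>, whereas the cube of a nonzero element is
    1.\<close>
  have "c ^ 2 \<noteq> 1"
  proof
    assume "c ^ 2 = 1"
    moreover have "c ^ 3 = c * c ^ 2"
      by (simp only: power3_eq_cube power2_eq_square mult.assoc)
    ultimately show False
      using c by (simp only: field4_cube) simp
  qed
  with c assms show ?thesis
    by (intro finite_field_power_sum_eq_0[of c]) auto
qed

lemma field4_sum_cubes: "(\<Sum>y::'a\<in>UNIV. y ^ 3) = 1"
proof -
  \<comment> \<open>Each of the three nonzero elements contributes 1, and 3 = 1 in characteristic
    2.\<close>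
  have "(\<Sum>y::'a\<in>UNIV. y ^ 3) = (\<Sum>y::'a\<in>UNIV - {0}. 1)"
    by (rule sum.mono_neutral_cong_right) (auto simp: field4_cube)
  also have "\<dots> = of_nat 3"
    using card4 by simp
  also have "\<dots> = 1"
    using field4_add_self[of 1] by (simp add: numeral_3_eq_3)
  finally show ?thesis .
qed

lemma field4_cubes_add_eq_1_iff:
  "x ^ 3 + y ^ 3 = (1::'a) \<longleftrightarrow> (x = 0) \<noteq> (y = 0)"
  using field4_add_self[of 1] by (auto simp: field4_cube)

lemma field4_cubic_coeff_eq_0:
  fixes s0 :: 'a
  assumes "bij (poly [:s0, s1, s2, s3:])"
  shows "s3 = 0"
proof -
  have "0 = (\<Sum>y::'a\<in>UNIV. y)"
    using field4_power_sum_eq_0[of 1] by simp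
  also have "\<dots> = (\<Sum>y\<in>UNIV. poly [:s0, s1, s2, s3:] y)"
    using sum.reindex_bij_betw[OF assms] by (rule sym)
  also have "\<dots> = (\<Sum>y\<in>UNIV. s0 + s1 * y ^ 1 + s2 * y ^ 2 + s3 * y ^ 3)"
    by (simp add: algebra_simps power2_eq_square power3_eq_cube)
  \<comment> \<open>All terms but the last vanish, the constant one because 4 = 0; the sum of cubes
    is 1, so \<open>s3\<close> remains.\<close>
  also have "\<dots> = of_nat CARD('a) * s0 + s1 * (\<Sum>y\<in>UNIV. y ^ 1)
      + s2 * (\<Sum>y\<in>UNIV. y ^ 2) + s3 * (\<Sum>y\<in>UNIV. y ^ 3)"
    by (simp add: sum.distrib sum_distrib_left)
  also have "\<dots> = s3"
    using field4_power_sum_eq_0[of 1] field4_power_sum_eq_0[of 2]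
    by (simp only: field4_sum_cubes finite_field_of_nat_card) simp
  finally show ?thesis
    by simp
qed

lemma field4_bij_quadratic_iff:
  fixes s0 :: 'a
  shows "bij (poly [:s0, s1, s2:]) \<longleftrightarrow> (s1 = 0) \<noteq> (s2 = 0)"
proof
  assume "bij (poly [:s0, s1, s2:])"
  then have inj: "x = y" if "poly [:s0, s1, s2:] x = poly [:s0, s1, s2:] y" for x y
    using that by (meson bij_is_inj injD)
  have "\<not> (s1 = 0 \<and> s2 = 0)"
    using inj[of 0 1] by auto
  \<comment> \<open>If both were nonzero, \<open>- s1 / s2\<close> would be a nonzero point with the
    same value \<open>s0\<close> as 0.\<close>
  moreover have "s1 = 0 \<or> s2 = 0"
    using inj[of "- s1 / s2" 0] by auto
  ultimately show "(s1 = 0) \<noteq> (s2 = 0)"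
    by auto
next
  assume s: "(s1 = 0) \<noteq> (s2 = 0)"
  have "x = y" if "poly [:s0, s1, s2:] x = poly [:s0, s1, s2:] y" for x y
  proof -
    have "s2 * (x * x) + s1 * x = s2 * (y * y) + s1 * y"
      using that by (simp add: algebra_simps)
    \<comment> \<open>Only one of the two terms is present, and its nonzero coefficient
      cancels.\<close>
    with s have "x = y \<or> x * x = y * y"
      by auto
    \<comment> \<open>Equal squares give \<open>x = y\<close> or \<open>x = - y\<close>; in
      characteristic 2 these coincide.\<close>
    moreover have "- y = y"
      using field4_add_self[of y] by (simp add: minus_unique)
    ultimately show ?thesis
      by (auto simp: square_eq_iff)
  qed
  then have "inj (poly [:s0, s1, s2:])"
    by (rule injI)
  then show "bij (poly [:s0, s1, s2:])"
    unfolding bij_def using finite_UNIV_inj_surj[OF finite] by blast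
qed

text \<open>The condition is kept free of cubes so that degrees can be read off by a case split on
  \<open>s2 = 0\<close>.\<close>

lemma field4_perm_polys_eq:
  "(perm_polys :: 'a poly set) = {[:s0, s1, s2:] | s0 s1 s2. (s1 = 0) \<noteq> (s2 = 0)}"
proof (intro equalityI subsetI)
  fix p :: "'a poly"
  assume "p \<in> perm_polys"
  then have deg: "degree p < 4" and bij: "bij (poly p)"
    by (auto simp: perm_polys_def card4)
  \<comment> \<open>The degree bound allows \<open>p\<close> to be written with four coefficients,
    the shape needed to eliminate the cubic one.\<close>
  have p: "p = [:coeff p 0, coeff p 1, coeff p 2, coeff p 3:]"
  proof (rule poly_eqI)
    fix n
    show "coeff p n = coeff [:coeff p 0, coeff p 1, coeff p 2, coeff p 3:] n"
    proof (cases "n < 4")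
      case True
      then have "n = 0 \<or> n = 1 \<or> n = 2 \<or> n = 3"
        by linarith
      then show ?thesis
        by (auto simp: numeral_2_eq_2 numeral_3_eq_3)
    next
      case False
      moreover have "degree [:coeff p 0, coeff p 1, coeff p 2, coeff p 3:] < 4"
        by simp
      ultimately show ?thesis
        using deg by (simp add: coeff_eq_0 del: coeff_pCons_0)
    qed
  qed
  with bij have "coeff p 3 = 0"
    by (metis field4_cubic_coeff_eq_0)
  with p have p': "p = [:coeff p 0, coeff p 1, coeff p 2:]"
    by simp
  with bij have "(coeff p 1 = 0) \<noteq> (coeff p 2 = 0)"
    by (metis field4_bij_quadratic_iff)
  with p' show "p \<in> {[:s0, s1, s2:] | s0 s1 s2. (s1 = 0) \<noteq> (s2 = 0)}"
    by blast
next
  fix p :: "'a poly"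
  assume "p \<in> {[:s0, s1, s2:] | s0 s1 s2. (s1 = 0) \<noteq> (s2 = 0)}"
  then obtain s0 s1 s2 where p: "p = [:s0, s1, s2:]" and s: "(s1 = 0) \<noteq> (s2 = 0)"
    by blast
  have "degree p < CARD('a)"
    by (simp add: p card4)
  moreover have "bij (poly p)"
    unfolding p field4_bij_quadratic_iff by (fact s)
  ultimately show "p \<in> perm_polys"
    by (simp add: perm_polys_def)
qed

lemma field4_perm_polys_degree:
  "degree p = 1 \<or> degree p = 2" if "p \<in> (perm_polys :: 'a poly set)"
proof -
  from that obtain s0 s1 s2 where "p = [:s0, s1, s2:]" "(s1 = 0) \<noteq> (s2 = 0)"
    unfolding field4_perm_polys_eq by blast
  then show ?thesis
    by (cases "s2 = 0") simp_all
qed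

lemma field4_perm_polys_deg_1_eq:
  "(perm_polys_deg 1 :: 'a poly set) = {[:s0, s1:] | s0 s1. s1 \<noteq> 0}" (is "_ = ?R")
proof (intro equalityI subsetI)
  fix p :: "'a poly"
  assume "p \<in> perm_polys_deg 1"
  then obtain s0 s1 s2 where "p = [:s0, s1, s2:]" "(s1 = 0) \<noteq> (s2 = 0)" "degree p = 1"
    unfolding perm_polys_deg_def field4_perm_polys_eq by blast
  then show "p \<in> ?R"
    by (cases "s2 = 0") simp_all
next
  fix p :: "'a poly"
  assume "p \<in> ?R"
  \<comment> \<open>The padding zero gives \<open>p\<close> the three-coefficient form of
    \<open>field4_perm_polys_eq\<close>.\<close>
  then obtain s0 s1 where "p = [:s0, s1, 0:]" "s1 \<noteq> 0"
    by auto
  moreover from this have "p \<in> perm_polys"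
    unfolding field4_perm_polys_eq by blast
  ultimately show "p \<in> perm_polys_deg 1"
    by (simp add: perm_polys_deg_def)
qed

text \<open>Degree 2 means \<open>s2\<close> is nonzero, which forces the linear coefficient to
  vanish.\<close>

lemma field4_perm_polys_deg_2_eq:
  "(perm_polys_deg 2 :: 'a poly set) = {[:s0, 0, s2:] | s0 s2. s2 \<noteq> 0}" (is "_ = ?R")
proof (intro equalityI subsetI)
  fix p :: "'a poly"
  assume "p \<in> perm_polys_deg 2"
  then obtain s0 s1 s2 where "p = [:s0, s1, s2:]" "(s1 = 0) \<noteq> (s2 = 0)" "degree p = 2"
    unfolding perm_polys_deg_def field4_perm_polys_eq by blast
  then show "p \<in> ?R"
    by (cases "s2 = 0") simp_all
next
  fix p :: "'a poly"
  assume "p \<in> ?R"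
  then obtain s0 s2 where "p = [:s0, 0, s2:]" "s2 \<noteq> 0"
    by blast
  moreover from this have "p \<in> perm_polys"
    unfolding field4_perm_polys_eq by blast
  ultimately show "p \<in> perm_polys_deg 2"
    by (simp add: perm_polys_deg_def)
qed

end

theorem proposition3p1:
  assumes "CARD('a::{field,finite}) = 4"
  shows "(perm_polys :: 'a poly set) = perm_polys_deg 1 \<union> perm_polys_deg 2
      \<and> (perm_polys_deg 1 :: 'a poly set) \<inter> perm_polys_deg 2 = {}
      \<and> (perm_polys :: 'a poly set) = {[:s0, s1, s2:] | s0 s1 s2. s1 ^ 3 + s2 ^ 3 = 1}
      \<and> (perm_polys_deg 1 :: 'a poly set) = {[:s0, s1:] | s0 s1. s1 ^ 3 = 1}
      \<and> (perm_polys_deg 2 :: 'a poly set) = {[:s0, 0, s2:] | s0 s2. s2 ^ 3 = 1}"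
proof (intro conjI)
  \<comment> \<open>This turns the nonvanishing conditions on leading coefficients into the cube
    conditions of the two fixed-degree descriptions.\<close>
  have cube: "x ^ 3 = 1 \<longleftrightarrow> x \<noteq> 0" for x :: 'a
    by (simp add: field4_cube[OF assms])
  show "(perm_polys :: 'a poly set) = perm_polys_deg 1 \<union> perm_polys_deg 2"
    by (auto simp: perm_polys_deg_def dest: field4_perm_polys_degree[OF assms])
  show "(perm_polys_deg 1 :: 'a poly set) \<inter> perm_polys_deg 2 = {}"
    by (auto simp: perm_polys_deg_def)
  show "(perm_polys :: 'a poly set) = {[:s0, s1, s2:] | s0 s1 s2. s1 ^ 3 + s2 ^ 3 = 1}"
    by (simp only: field4_perm_polys_eq[OF assms] field4_cubes_add_eq_1_iff[OF assms])
  show "(perm_polys_deg 1 :: 'a poly set) = {[:s0, s1:] | s0 s1. s1 ^ 3 = 1}"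
    by (simp only: field4_perm_polys_deg_1_eq[OF assms] cube)
  show "(perm_polys_deg 2 :: 'a poly set) = {[:s0, 0, s2:] | s0 s2. s2 ^ 3 = 1}"
    by (simp only: field4_perm_polys_deg_2_eq[OF assms] cube)
qed

end
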